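(* Fix a realization of the satellite positions such that $\tilde{\mathbf J}$ is nonsingular, fix $\rho>0$, and suppose $\eta=\kappa W_e^2$ for a constant $\kappa>0$ independent of the effective bandwidth $W_e>0$. Then, as $W_e\to\infty$, $\|\mathbf J^{-1}-\tilde{\mathbf J}^{-1}\|=o(W_e^{-2})$; consequently $\mathrm{CRB}_{xy}-\widetilde{\mathrm{CRB}}_{xy}=o(W_e^{-2})$ and $\mathrm{CRB}_z-\widetilde{\mathrm{CRB}}_z=o(W_e^{-2})$.
   Context: With satellites indexed $i=1,\dots,N$, distances $D_i>0$ to the receiver, local zenith angles $\phi_{L,i}$, azimuths $\theta_i$, visibility indicators $\mathbf 1_i$ (visible iff $\phi_{L,i}\le\phi_{L,\max}$), set $L_i=2\eta\rho/D_i^2$, $K_i=\frac{2\rho}{D_i^4}(1+\eta D_i^2)$, $u_i=(\sin\phi_{L,i}\cos\theta_i,\sin\phi_{L,i}\sin\theta_i,\cos\phi_{L,i})^T$. The RSS+TDOA Fisher information matrix is $\mathbf J=\sum_i\mathbf 1_i\begin{pmatrix}K_iu_iu_i^T & L_iu_i\\ L_iu_i^T & L_i\end{pmatrix}$ and the TDOA-only one is $\tilde{\mathbf J}=\sum_i\mathbf 1_iL_i\begin{pmatrix}u_iu_i^T & u_i\\ u_i^T&1\end{pmatrix}$ (parameters ordered $x,y,z,T_0$). $\mathrm{CRB}_{xy}=[\mathbf J^{-1}]_{11}+[\mathbf J^{-1}]_{22}$, $\mathrm{CRB}_z=[\mathbf J^{-1}]_{33}$, and analogously with tildes for $\tilde{\mathbf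 J}$. $\|\cdot\|$ is any matrix norm. *)

theory Defs
  imports "HOL-Analysis.Analysis" "HOL-Library.Landau_Symbols"
begin

text \<open>Parameters are ordered (x, y, z, T0); they are indexed 1,2,3,4 in real^4
  (via the library function vector, whose first entry has index 1).\<close>

definition outer4 :: "real^4 \<Rightarrow> real^4 \<Rightarrow> real^4^4" where
  "outer4 a b = (\<chi> i j. a $ i * b $ j)"

text \<open>Unit line-of-sight vector u_i, padded with a zero T0-component.\<close>
definition u0 :: "real \<Rightarrow> real \<Rightarrow> real^4" where
  "u0 phi theta = vector [sin phi * cos theta, sin phi * sin theta, cos phi, 0]"

text \<open>e4: the T0 coordinate vector.\<close>
definition e4 :: "real^4" where
  "e4 = vector [0, 0, 0, 1]"

definition Lcoef :: "real \<Rightarrow> real \<Rightarrow> real \<Rightarrow> real" where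
  "Lcoef eta rho D = 2 * eta * rho / D^2"

definition Kcoef :: "real \<Rightarrow> real \<Rightarrow> real \<Rightarrow> real" where
  "Kcoef eta rho D = 2 * rho / D^4 * (1 + eta * D^2)"

text \<open>Block matrix [K u u^T, L u; L u^T, L] as a 4x4 matrix.\<close>
definition blockJ :: "real \<Rightarrow> real \<Rightarrow> real \<Rightarrow> real \<Rightarrow> real \<Rightarrow> real^4^4" where
  "blockJ eta rho D phi theta =
     Kcoef eta rho D *\<^sub>R outer4 (u0 phi theta) (u0 phi theta)
   + Lcoef eta rho D *\<^sub>R outer4 (u0 phi theta) e4
   + Lcoef eta rho D *\<^sub>R outer4 e4 (u0 phi theta)
   + Lcoef eta rho D *\<^sub>R outer4 e4 e4"

text \<open>Block matrix L [u u^T, u; u^T, 1].\<close>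
definition blockJt :: "real \<Rightarrow> real \<Rightarrow> real \<Rightarrow> real \<Rightarrow> real \<Rightarrow> real^4^4" where
  "blockJt eta rho D phi theta =
     Lcoef eta rho D *\<^sub>R outer4 (u0 phi theta + e4) (u0 phi theta + e4)"

text \<open>RSS+TDOA FIM: sum over the visible satellites i = 1..N.\<close>
definition FIM :: "nat \<Rightarrow> (nat \<Rightarrow> real) \<Rightarrow> (nat \<Rightarrow> real) \<Rightarrow> (nat \<Rightarrow> real) \<Rightarrow> real
    \<Rightarrow> real \<Rightarrow> real \<Rightarrow> real^4^4" where
  "FIM N D phi theta phimax eta rho =
     (\<Sum>i\<in>{1..N}. (if phi i \<le> phimax then 1 else 0) *\<^sub>R blockJ eta rho (D i) (phi i) (theta i))"

text \<open>TDOA-only FIM.\<close>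
definition FIMt :: "nat \<Rightarrow> (nat \<Rightarrow> real) \<Rightarrow> (nat \<Rightarrow> real) \<Rightarrow> (nat \<Rightarrow> real) \<Rightarrow> real
    \<Rightarrow> real \<Rightarrow> real \<Rightarrow> real^4^4" where
  "FIMt N D phi theta phimax eta rho =
     (\<Sum>i\<in>{1..N}. (if phi i \<le> phimax then 1 else 0) *\<^sub>R blockJt eta rho (D i) (phi i) (theta i))"

definition CRB_xy :: "real^4^4 \<Rightarrow> real" where
  "CRB_xy J = matrix_inv J $ 1 $ 1 + matrix_inv J $ 2 $ 2"

definition CRB_z :: "real^4^4 \<Rightarrow> real" where
  "CRB_z J = matrix_inv J $ 3 $ 3"

end

theory Submission
  imports Defs "HOL-Real_Asymp.Real_Asymp"
begin

(* The TDOA-only matrix is linear in eta, Jt = eta M, and the full matrix differs from it by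
   the eta-independent RSS information A: J = eta M + A.  The resolvent identity
   J^-1 - Jt^-1 = J^-1 (-A) Jt^-1, together with the bound O(1/eta) for both inverses
   (eta M + A is bounded below by eta / (2 |M^-1|) once eta is large), gives
   |J^-1 - Jt^-1| = O(eta^-2) = O(W^-4).  Matrix entries, and hence the CRB differences,
   are bounded by the operator norm. *)

lemma matrix_inv_right:
  fixes A :: "'a::semiring_1^'n^'m"
  assumes "invertible A"
  shows "A ** matrix_inv A = mat 1"
  using assms unfolding matrix_inv_def invertible_def by (rule someI_ex[THEN conjunct1])

lemma matrix_inv_left:
  fixes A :: "'a::semiring_1^'n^'m"
  assumes "invertible A"
  shows "matrix_inv A ** A = mat 1"
  using assms unfolding matrix_inv_def invertible_def by (rule someI_ex[THEN conjunct2])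

lemma matrix_inv_unique:
  fixes A B :: "'a::field^'n^'n"
  assumes "B ** A = mat 1"
  shows "matrix_inv A = B"
proof -
  have "invertible A"
    using assms invertible_left_inverse by blast
  then have "B ** (A ** matrix_inv A) = B"
    by (simp add: matrix_inv_right)
  then show ?thesis
    by (simp add: matrix_mul_assoc assms)
qed

lemma matrix_inv_scaleR:
  fixes A :: "real^'n^'n"
  assumes "c \<noteq> 0" and "invertible A"
  shows "matrix_inv (c *\<^sub>R A) = inverse c *\<^sub>R matrix_inv A"
  by (rule matrix_inv_unique)
    (use assms in \<open>simp add: matrix_scalar_ac scalar_matrix_assoc[symmetric] matrix_inv_left\<close>)

lemma matrix_inv_diff:
  fixes A B :: "'a::field^'n^'n"
  assumes "invertible A" and "invertible B"
  shows "matrix_inv A - matrix_inv B = matrix_inv A ** (B - A) ** matrix_inv B"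
proof -
  have "matrix_inv A ** (B - A) ** matrix_inv B
      = matrix_inv A ** (B ** matrix_inv B) - (matrix_inv A ** A) ** matrix_inv B"
    by (simp add: matrix_eq matrix_vector_mul_assoc[symmetric] algebra_simps)
  then show ?thesis
    using assms by (simp add: matrix_inv_left matrix_inv_right)
qed

lemma onorm_matrix_mult_le:
  fixes A :: "real^'n^'m" and B :: "real^'k^'n"
  shows "onorm ((*v) (A ** B)) \<le> onorm ((*v) A) * onorm ((*v) B)"
proof -
  have "(*v) (A ** B) = (*v) A \<circ> (*v) B"
    by (simp add: fun_eq_iff matrix_vector_mul_assoc)
  then show ?thesis
    by (simp add: onorm_compose)
qed

lemma norm_le_onorm_matrix:
  fixes A :: "real^'n^'m"
  shows "norm A \<le> real CARD('m) * real CARD('n) * onorm ((*v) A)"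
proof -
  have "norm A \<le> (\<Sum>i\<in>UNIV. norm (A $ i))"
    unfolding norm_vec_def by (rule L2_set_le_sum) simp
  also have "\<dots> \<le> (\<Sum>i\<in>UNIV. \<Sum>j\<in>UNIV. \<bar>A $ i $ j\<bar>)"
    by (intro sum_mono norm_le_l1_cart)
  also have "\<dots> \<le> (\<Sum>i::'m\<in>UNIV. \<Sum>j::'n\<in>UNIV. onorm ((*v) A))"
    by (intro sum_mono matrix_component_le_onorm)
  finally show ?thesis
    by simp
qed

lemma onorm_matrix_inv_le_if_bounded_below:
  fixes A :: "real^'n^'n"
  assumes "c > 0" and "\<And>v. c * norm v \<le> norm (A *v v)"
  shows "invertible A" and "onorm ((*v) (matrix_inv A)) \<le> inverse c"
proof -
  have "A *v v = 0 \<Longrightarrow> v = 0" for v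
    using assms(1) assms(2)[of v] by (simp add: mult_le_0_iff)
  then show inv: "invertible A"
    using matrix_left_invertible_ker invertible_left_inverse by blast
  show "onorm ((*v) (matrix_inv A)) \<le> inverse c"
  proof (rule onorm_le)
    fix w
    have "c * norm (matrix_inv A *v w) \<le> norm w"
      using assms(2)[of "matrix_inv A *v w"]
      by (simp add: matrix_vector_mul_assoc matrix_inv_right inv)
    then show "norm (matrix_inv A *v w) \<le> inverse c * norm w"
      using \<open>c > 0\<close> by (simp add: field_simps)
  qed
qed

lemma eventually_onorm_matrix_inv_scaleR_add_le:
  fixes M A :: "real^'n^'n"
  assumes "invertible M"
  obtains b where "eventually (\<lambda>e. invertible (e *\<^sub>R M + A)
      \<and> onorm ((*v) (matrix_inv (e *\<^sub>R M + A))) \<le> b / e) at_top"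
proof -
  obtain b where b: "b > 0" "\<And>w. norm (matrix_inv M *v w) \<le> b * norm w"
    using linear_bounded_pos[OF matrix_vector_mul_linear] by blast
  define a where "a = onorm ((*v) A)"
  have M_below: "norm v \<le> b * norm (M *v v)" for v
    using b(2)[of "M *v v"] assms by (simp add: matrix_vector_mul_assoc matrix_inv_left)
  have "eventually (\<lambda>e. invertible (e *\<^sub>R M + A)
      \<and> onorm ((*v) (matrix_inv (e *\<^sub>R M + A))) \<le> (2 * b) / e) at_top"
    using eventually_ge_at_top[of "max 1 (2 * a * b)"]
  proof eventually_elim
    case (elim e)
    then have "e > 0" "2 * a * b \<le> e" by auto
    have below: "e / (2 * b) * norm v \<le> norm ((e *\<^sub>R M + A) *v v)" for v
    proof -
      have "e / (2 * b) \<le> e / b - a"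
        using \<open>2 * a * b \<le> e\<close> \<open>b > 0\<close> by (simp add: field_simps)
      then have "e / (2 * b) * norm v \<le> e / b * norm v - a * norm v"
        by (metis left_diff_distrib mult_right_mono norm_ge_zero)
      also have "\<dots> \<le> e * norm (M *v v) - norm (A *v v)"
      proof -
        have "e / b * norm v \<le> e * norm (M *v v)"
          using mult_left_mono[OF M_below[of v], of e] \<open>e > 0\<close> \<open>b > 0\<close>
          by (simp add: field_simps)
        moreover have "norm (A *v v) \<le> a * norm v"
          unfolding a_def by (rule onorm[OF matrix_vector_mul_bounded_linear])
        ultimately show ?thesis
          by linarith
      qed
      also have "\<dots> \<le> norm ((e *\<^sub>R M + A) *v v)"
        using norm_diff_ineq[of "e *\<^sub>R (M *v v)" "A *v v"] \<open>e > 0\<close>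
        by (simp add: matrix_vector_mult_add_rdistrib scaleR_matrix_vector_assoc[symmetric])
      finally show ?thesis .
    qed
    have "e / (2 * b) > 0"
      using \<open>e > 0\<close> \<open>b > 0\<close> by simp
    from onorm_matrix_inv_le_if_bounded_below[OF this below] show ?case
      by simp
  qed
  then show ?thesis
    by (rule that)
qed

lemma onorm_matrix_inv_scaleR_add_diff_bigo:
  fixes M A :: "real^'n^'n"
  assumes "invertible M"
  shows "(\<lambda>e. onorm ((*v) (matrix_inv (e *\<^sub>R M + A) - matrix_inv (e *\<^sub>R M))))
    \<in> O[at_top](\<lambda>e. 1 / e^2)"
proof -
  obtain b where b: "eventually (\<lambda>e. invertible (e *\<^sub>R M + A)
      \<and> onorm ((*v) (matrix_inv (e *\<^sub>R M + A))) \<le> b / e) at_top"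
    using eventually_onorm_matrix_inv_scaleR_add_le[OF assms] .
  define a where "a = onorm ((*v) (- A))"
  define m where "m = onorm ((*v) (matrix_inv M))"
  show ?thesis
  proof (rule bigoI)
    show "eventually (\<lambda>e. norm (onorm ((*v) (matrix_inv (e *\<^sub>R M + A) - matrix_inv (e *\<^sub>R M))))
        \<le> b * a * m * norm (1 / e^2)) at_top"
      using b eventually_gt_at_top[of 0]
    proof eventually_elim
      case (elim e)
      then have X: "invertible (e *\<^sub>R M + A)"
        and X_bound: "onorm ((*v) (matrix_inv (e *\<^sub>R M + A))) \<le> b / e"
        and "e > 0" by auto
      have eM: "invertible (e *\<^sub>R M)"
        using assms \<open>e > 0\<close> by (simp add: scalar_invertible)
      have eM_bound: "onorm ((*v) (matrix_inv (e *\<^sub>R M))) = m / e"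
      proof -
        have "(*v) (matrix_inv (e *\<^sub>R M)) = (\<lambda>x. inverse e *\<^sub>R (matrix_inv M *v x))"
          using matrix_inv_scaleR[of e M] assms \<open>e > 0\<close>
          by (simp add: fun_eq_iff scaleR_matrix_vector_assoc)
        then show ?thesis
          using onorm_scaleR[OF matrix_vector_mul_bounded_linear, of "inverse e" "matrix_inv M"] \<open>e > 0\<close>
          by (simp add: m_def divide_inverse mult.commute)
      qed
      have "onorm ((*v) (matrix_inv (e *\<^sub>R M + A) - matrix_inv (e *\<^sub>R M)))
          = onorm ((*v) (matrix_inv (e *\<^sub>R M + A) ** (- A) ** matrix_inv (e *\<^sub>R M)))"
        using matrix_inv_diff[OF X eM] by simp
      also have "\<dots> \<le> onorm ((*v) (matrix_inv (e *\<^sub>R M + A))) * a * (m / e)"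
        unfolding a_def eM_bound[symmetric]
        by (rule order_trans[OF onorm_matrix_mult_le
              mult_right_mono[OF onorm_matrix_mult_le onorm_pos_le[OF matrix_vector_mul_bounded_linear]]])
      also have "\<dots> \<le> b / e * a * (m / e)"
        using X_bound \<open>e > 0\<close>
        by (intro mult_right_mono) (simp_all add: a_def m_def onorm_pos_le)
      finally show ?case
        using \<open>e > 0\<close> by (simp add: onorm_pos_le power2_eq_square)
    qed
  qed
qed

lemma onorm_matrix_inv_scaleR_add_diff_smallo:
  fixes M A :: "real^'n^'n"
  assumes "invertible M" and "kappa > 0"
  shows "(\<lambda>W. onorm ((*v) (matrix_inv ((kappa * W^2) *\<^sub>R M + A) - matrix_inv ((kappa * W^2) *\<^sub>R M))))
    \<in> o[at_top](\<lambda>W. 1 / W^2)"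
proof -
  have "filterlim (\<lambda>W. kappa * W^2) at_top at_top"
    using \<open>kappa > 0\<close> by real_asymp
  from landau_o.big.compose[OF onorm_matrix_inv_scaleR_add_diff_bigo[OF \<open>invertible M\<close>] this]
  have "(\<lambda>W. onorm ((*v) (matrix_inv ((kappa * W^2) *\<^sub>R M + A) - matrix_inv ((kappa * W^2) *\<^sub>R M))))
      \<in> O[at_top](\<lambda>W. 1 / (kappa * W^2)^2)" .
  moreover have "(\<lambda>W. 1 / (kappa * W^2)^2) \<in> o[at_top](\<lambda>W. 1 / W^2)"
    using \<open>kappa > 0\<close> by real_asymp
  ultimately show ?thesis
    by (rule landau_o.big_small_trans)
qed

lemma smallo_if_abs_le_const_mult:
  fixes f g :: "'a \<Rightarrow> real"
  assumes "\<And>x. \<bar>f x\<bar> \<le> c * g x" and "g \<in> o[F](h)"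
  shows "f \<in> o[F](h)"
proof (rule landau_o.big_small_trans[OF bigoI[of _ "\<bar>c\<bar>"] assms(2)])
  show "eventually (\<lambda>x. norm (f x) \<le> \<bar>c\<bar> * norm (g x)) F"
    using assms(1) by (intro always_eventually allI) (metis abs_ge_self abs_mult order_trans real_norm_def)
qed

(* K_i - L_i = 2 rho / D_i^4: the RSS contribution to J, the only part not proportional to eta. *)
definition FIM_RSS :: "nat \<Rightarrow> (nat \<Rightarrow> real) \<Rightarrow> (nat \<Rightarrow> real) \<Rightarrow> (nat \<Rightarrow> real) \<Rightarrow> real
    \<Rightarrow> real \<Rightarrow> real^4^4" where
  "FIM_RSS N D phi theta phimax rho =
     (\<Sum>i\<in>{1..N}. (if phi i \<le> phimax then 1 else 0) *\<^sub>R
        (2 * rho / D i ^ 4) *\<^sub>R outer4 (u0 (phi i) (theta i)) (u0 (phi i) (theta i)))"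

lemma outer4_add_left: "outer4 (a + b) c = outer4 a c + outer4 b c"
  by (simp add: outer4_def vec_eq_iff algebra_simps)

lemma outer4_add_right: "outer4 a (b + c) = outer4 a b + outer4 a c"
  by (simp add: outer4_def vec_eq_iff algebra_simps)

lemma blockJt_eq_scaleR: "blockJt eta rho D phi theta = eta *\<^sub>R blockJt 1 rho D phi theta"
  by (simp add: blockJt_def Lcoef_def)

lemma blockJ_eq_blockJt_plus:
  "blockJ eta rho D phi theta
     = blockJt eta rho D phi theta + (2 * rho / D ^ 4) *\<^sub>R outer4 (u0 phi theta) (u0 phi theta)"
proof -
  have "Kcoef eta rho D = 2 * rho / D ^ 4 + Lcoef eta rho D"
    by (cases "D = 0") (simp_all add: Kcoef_def Lcoef_def field_simps power4_eq_xxxx power2_eq_square)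
  then show ?thesis
    unfolding blockJ_def blockJt_def
    by (simp add: outer4_add_left outer4_add_right scaleR_add_left scaleR_add_right algebra_simps)
qed

lemma FIMt_eq_scaleR:
  "FIMt N D phi theta phimax eta rho = eta *\<^sub>R FIMt N D phi theta phimax 1 rho"
  unfolding FIMt_def by (subst blockJt_eq_scaleR) (simp add: scaleR_sum_right mult.commute)

lemma FIM_eq_FIMt_plus_FIM_RSS:
  "FIM N D phi theta phimax eta rho
     = FIMt N D phi theta phimax eta rho + FIM_RSS N D phi theta phimax rho"
  unfolding FIM_def FIMt_def FIM_RSS_def blockJ_eq_blockJt_plus
  by (simp add: scaleR_add_right sum.distrib)

theorem mainTheorem4:
  fixes N :: nat and D phi theta :: "nat \<Rightarrow> real"
    and phimax rho kappa :: real
  assumes D_pos: "\<And>i. i \<in> {1..N} \<Longrightarrow> D i > 0"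
    and rho_pos: "rho > 0"
    and kappa_pos: "kappa > 0"
    and nonsing: "\<And>W. W > 0 \<Longrightarrow> invertible (FIMt N D phi theta phimax (kappa * W^2) rho)"
  shows "(\<lambda>W. norm (matrix_inv (FIM N D phi theta phimax (kappa * W^2) rho)
                    - matrix_inv (FIMt N D phi theta phimax (kappa * W^2) rho)))
           \<in> o[at_top](\<lambda>W. 1 / W^2)
     \<and> (\<lambda>W. CRB_xy (FIM N D phi theta phimax (kappa * W^2) rho)
              - CRB_xy (FIMt N D phi theta phimax (kappa * W^2) rho))
           \<in> o[at_top](\<lambda>W. 1 / W^2)
     \<and> (\<lambda>W. CRB_z (FIM N D phi theta phimax (kappa * W^2) rho)
              - CRB_z (FIMt N D phi theta phimax (kappa * W^2) rho))
           \<in> o[at_top](\<lambda>W. 1 / W^2)"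
proof -
  define Mt where "Mt = FIMt N D phi theta phimax 1 rho"
  define Delta where "Delta W = matrix_inv (FIM N D phi theta phimax (kappa * W^2) rho)
    - matrix_inv (FIMt N D phi theta phimax (kappa * W^2) rho)" for W
  have "invertible (kappa *\<^sub>R Mt)"
    using nonsing[of 1] by (simp add: Mt_def FIMt_eq_scaleR[of _ _ _ _ _ kappa])
  then have Mt_inv: "invertible Mt"
    using scalar_invertible[of "inverse kappa" "kappa *\<^sub>R Mt"] kappa_pos by simp
  have Delta_eq: "Delta W = matrix_inv ((kappa * W^2) *\<^sub>R Mt + FIM_RSS N D phi theta phimax rho)
      - matrix_inv ((kappa * W^2) *\<^sub>R Mt)" for W
    unfolding Delta_def Mt_def FIM_eq_FIMt_plus_FIM_RSS by (subst (1 2) FIMt_eq_scaleR) (rule refl)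
  have Delta_small: "(\<lambda>W. onorm ((*v) (Delta W))) \<in> o[at_top](\<lambda>W. 1 / W^2)"
    unfolding Delta_eq by (rule onorm_matrix_inv_scaleR_add_diff_smallo[OF Mt_inv kappa_pos])
  have "(\<lambda>W. norm (Delta W)) \<in> o[at_top](\<lambda>W. 1 / W^2)"
    using norm_le_onorm_matrix[of "Delta _"]
    by (intro smallo_if_abs_le_const_mult[OF _ Delta_small, of _ 16]) simp
  moreover have "(\<lambda>W. CRB_xy (FIM N D phi theta phimax (kappa * W^2) rho)
      - CRB_xy (FIMt N D phi theta phimax (kappa * W^2) rho)) \<in> o[at_top](\<lambda>W. 1 / W^2)"
  proof (rule smallo_if_abs_le_const_mult[OF _ Delta_small, of _ 2])
    fix W
    show "\<bar>CRB_xy (FIM N D phi theta phimax (kappa * W^2) rho)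
        - CRB_xy (FIMt N D phi theta phimax (kappa * W^2) rho)\<bar> \<le> 2 * onorm ((*v) (Delta W))"
      using abs_triangle_ineq[of "Delta W $ 1 $ 1" "Delta W $ 2 $ 2"]
        matrix_component_le_onorm[of "Delta W" 1 1] matrix_component_le_onorm[of "Delta W" 2 2]
      by (simp add: CRB_xy_def Delta_def)
  qed
  moreover have "(\<lambda>W. CRB_z (FIM N D phi theta phimax (kappa * W^2) rho)
      - CRB_z (FIMt N D phi theta phimax (kappa * W^2) rho)) \<in> o[at_top](\<lambda>W. 1 / W^2)"
    using matrix_component_le_onorm[of "Delta _" 3 3]
    by (intro smallo_if_abs_le_const_mult[OF _ Delta_small, of _ 1]) (simp add: CRB_z_def Delta_def)
  ultimately show ?thesis
    unfolding Delta_def by blast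
qed

end
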